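(* Let $\mathcal{H}$ be a Hilbert space of finite dimension $d$. Any classical coding procedure on $\mathcal{H}$ has coding imperfection $$\Delta\ \ge\ \frac{d-1}{d+1}.$$
   Context: A CP-map between von Neumann algebras is a linear, unital, completely positive map that is weakly continuous, in the sense that it pulls back normal states to normal states. A classical coding procedure on $\mathcal{H}$ consists of a commutative von Neumann algebra $\mathcal{A}$ and a pair of CP-maps $C:\mathcal{A}\to\mathcal{B}(\mathcal{H})$ and $D:\mathcal{B}(\mathcal{H})\to\mathcal{A}$. Its coding imperfection is $\Delta=\sup\{\|B-C(D(B))\|\,:\,B\in\mathcal{B}(\mathcal{H}),\ 0\le B\le\mathbf 1\}$. Here $\mathcal{B}(\mathcal{H})$ is the algebra of bounded linear operators on $\mathcal{H}$. *)

theory Defs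
  imports "HOL-Analysis.Analysis"
begin

section \<open>Complex Hilbert spaces\<close>

text \<open>The inner product is linear in the second argument. Completeness and the compatible real
  normed structure come from the class \<^class>\<open>banach\<close>; the trivial space is not excluded.\<close>

class chilbert_space = banach +
  fixes scaleC :: "complex \<Rightarrow> 'a \<Rightarrow> 'a" (infixr "*\<^sub>C" 75)
    and cinner :: "'a \<Rightarrow> 'a \<Rightarrow> complex"
  assumes scaleC_add_right: "c *\<^sub>C (x + y) = c *\<^sub>C x + c *\<^sub>C y"
    and scaleC_add_left: "(c + c') *\<^sub>C x = c *\<^sub>C x + c' *\<^sub>C x"
    and scaleC_scaleC: "c *\<^sub>C c' *\<^sub>C x = (c * c') *\<^sub>C x"
    and scaleC_of_real: "complex_of_real r *\<^sub>C x = r *\<^sub>R x"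
    and cinner_add_right: "cinner x (y + z) = cinner x y + cinner x z"
    and cinner_scaleC_right: "cinner x (c *\<^sub>C y) = c * cinner x y"
    and cinner_commute: "cinner x y = cnj (cinner y x)"
    and cinner_self_nonneg: "cinner x x \<in> \<real>\<^sub>\<ge>\<^sub>0"
    and norm_eq_sqrt_cinner: "norm x = sqrt (Re (cinner x x))"

lemma vector_space_scaleC: "vector_space (scaleC :: complex \<Rightarrow> 'a::chilbert_space \<Rightarrow> 'a)"
proof
  show "1 *\<^sub>C x = x" for x :: 'a
    using scaleC_of_real[of 1 x] by simp
qed (simp_all add: scaleC_add_right scaleC_add_left scaleC_scaleC)

lemma norm_scaleC: "norm (c *\<^sub>C x) = cmod c * norm (x :: 'a::chilbert_space)"
proof -
  have "cinner (c *\<^sub>C x) (c *\<^sub>C x) = c * (cnj c * cinner x x)"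
    by (metis cinner_commute cinner_scaleC_right complex_cnj_cnj complex_cnj_mult)
  also have "\<dots> = complex_of_real ((cmod c)\<^sup>2) * cinner x x"
    using complex_norm_square[of c] by simp
  finally have "Re (cinner (c *\<^sub>C x) (c *\<^sub>C x)) = (cmod c)\<^sup>2 * Re (cinner x x)"
    by simp
  then show ?thesis
    by (simp add: norm_eq_sqrt_cinner real_sqrt_mult)
qed

lemma bounded_linear_scaleC: "bounded_linear (\<lambda>x :: 'a::chilbert_space. c *\<^sub>C x)"
proof (rule bounded_linear_intro[where K = "cmod c"])
  fix r and x :: 'a
  show "c *\<^sub>C r *\<^sub>R x = r *\<^sub>R c *\<^sub>C x"
    by (simp add: scaleC_of_real[symmetric] scaleC_scaleC mult.commute)
qed (simp_all add: scaleC_add_right norm_scaleC mult.commute)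


section \<open>Bounded operators\<close>

text \<open>Bounded operators are the complex-linear elements of the type of bounded real-linear maps;
  the norm on that type is the operator norm.\<close>

definition bops :: "('a::chilbert_space \<Rightarrow>\<^sub>L 'a) set" where
  "bops = {A. \<forall>c x. blinfun_apply A (c *\<^sub>C x) = c *\<^sub>C blinfun_apply A x}"

definition op_scaleC :: "complex \<Rightarrow> ('a::chilbert_space \<Rightarrow>\<^sub>L 'a) \<Rightarrow> ('a \<Rightarrow>\<^sub>L 'a)" where
  "op_scaleC c A = Blinfun (\<lambda>x. c *\<^sub>C blinfun_apply A x)"

lemma op_scaleC_apply [simp]: "blinfun_apply (op_scaleC c A) x = c *\<^sub>C blinfun_apply A x"
  unfolding op_scaleC_def
  by (simp add: bounded_linear_Blinfun_apply bounded_linear_compose[OF bounded_linear_scaleC]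
      blinfun.bounded_linear_right)

definition is_adjoint ::
    "('a::chilbert_space \<Rightarrow>\<^sub>L 'a) \<Rightarrow> ('a \<Rightarrow>\<^sub>L 'a) \<Rightarrow> bool" where
  "is_adjoint A B \<longleftrightarrow> (\<forall>x y. cinner (blinfun_apply A x) y = cinner x (blinfun_apply B y))"

definition op_positive :: "('a::chilbert_space \<Rightarrow>\<^sub>L 'a) \<Rightarrow> bool" where
  "op_positive A \<longleftrightarrow> (\<forall>x. cinner x (blinfun_apply A x) \<in> \<real>\<^sub>\<ge>\<^sub>0)"

definition op_le :: "('a::chilbert_space \<Rightarrow>\<^sub>L 'a) \<Rightarrow> ('a \<Rightarrow>\<^sub>L 'a) \<Rightarrow> bool" where
  "op_le A B \<longleftrightarrow> op_positive (B - A)"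


section \<open>Von Neumann algebras\<close>

definition commutant :: "('a::chilbert_space \<Rightarrow>\<^sub>L 'a) set \<Rightarrow> ('a \<Rightarrow>\<^sub>L 'a) set" where
  "commutant M = {T \<in> bops. \<forall>A\<in>M. T o\<^sub>L A = A o\<^sub>L T}"

definition von_neumann_algebra :: "('a::chilbert_space \<Rightarrow>\<^sub>L 'a) set \<Rightarrow> bool" where
  "von_neumann_algebra M \<longleftrightarrow>
     M \<subseteq> bops \<and> (\<forall>A\<in>M. \<exists>B\<in>M. is_adjoint A B) \<and> commutant (commutant M) = M"

definition commutative_algebra :: "('a::chilbert_space \<Rightarrow>\<^sub>L 'a) set \<Rightarrow> bool" where
  "commutative_algebra M \<longleftrightarrow> (\<forall>A\<in>M. \<forall>B\<in>M. A o\<^sub>L B = B o\<^sub>L A)"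

definition self_adjoint_part :: "('a::chilbert_space \<Rightarrow>\<^sub>L 'a) set \<Rightarrow> ('a \<Rightarrow>\<^sub>L 'a) set" where
  "self_adjoint_part M = {A \<in> M. is_adjoint A A}"

definition is_op_sup ::
    "('a::chilbert_space \<Rightarrow>\<^sub>L 'a) set \<Rightarrow> ('a \<Rightarrow>\<^sub>L 'a) set \<Rightarrow> ('a \<Rightarrow>\<^sub>L 'a) \<Rightarrow> bool" where
  "is_op_sup M S A \<longleftrightarrow>
     A \<in> self_adjoint_part M \<and> (\<forall>B\<in>S. op_le B A) \<and>
     (\<forall>C\<in>self_adjoint_part M. (\<forall>B\<in>S. op_le B C) \<longrightarrow> op_le A C)"

definition op_directed :: "('a::chilbert_space \<Rightarrow>\<^sub>L 'a) set \<Rightarrow> bool" where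
  "op_directed S \<longleftrightarrow> S \<noteq> {} \<and> (\<forall>A\<in>S. \<forall>B\<in>S. \<exists>C\<in>S. op_le A C \<and> op_le B C)"

definition state_on ::
    "('a::chilbert_space \<Rightarrow>\<^sub>L 'a) set \<Rightarrow> (('a \<Rightarrow>\<^sub>L 'a) \<Rightarrow> complex) \<Rightarrow> bool" where
  "state_on M \<omega> \<longleftrightarrow>
     (\<forall>A\<in>M. \<forall>B\<in>M. \<omega> (A + B) = \<omega> A + \<omega> B) \<and>
     (\<forall>c. \<forall>A\<in>M. \<omega> (op_scaleC c A) = c * \<omega> A) \<and>
     (\<forall>A\<in>M. op_positive A \<longrightarrow> \<omega> A \<in> \<real>\<^sub>\<ge>\<^sub>0) \<and>
     \<omega> id_blinfun = 1"

text \<open>A state is normal if it preserves suprema of bounded upward directed families of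
  self-adjoint elements. States are real and monotone on self-adjoint elements, so the real
  supremum below is over a bounded nonempty set.\<close>

definition normal_state ::
    "('a::chilbert_space \<Rightarrow>\<^sub>L 'a) set \<Rightarrow> (('a \<Rightarrow>\<^sub>L 'a) \<Rightarrow> complex) \<Rightarrow> bool" where
  "normal_state M \<omega> \<longleftrightarrow>
     state_on M \<omega> \<and>
     (\<forall>S A. S \<subseteq> self_adjoint_part M \<and> op_directed S \<and> is_op_sup M S A \<longrightarrow>
        \<omega> A = complex_of_real (SUP B\<in>S. Re (\<omega> B)))"


section \<open>CP-maps\<close>

text \<open>Positivity of the \<open>n\<close> by \<open>n\<close> operator matrix \<open>P\<close>, acting on the \<open>n\<close>-fold direct sum of the
  underlying Hilbert space. Only the entries with indices below \<open>n\<close> matter.\<close>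

definition matrix_positive ::
    "nat \<Rightarrow> (nat \<Rightarrow> nat \<Rightarrow> ('a::chilbert_space \<Rightarrow>\<^sub>L 'a)) \<Rightarrow> bool" where
  "matrix_positive n P \<longleftrightarrow>
     (\<forall>x :: nat \<Rightarrow> 'a. (\<Sum>i<n. \<Sum>j<n. cinner (x i) (blinfun_apply (P i j) (x j))) \<in> \<real>\<^sub>\<ge>\<^sub>0)"

definition completely_positive_on ::
    "('a::chilbert_space \<Rightarrow>\<^sub>L 'a) set \<Rightarrow>
     (('a \<Rightarrow>\<^sub>L 'a) \<Rightarrow> ('b::chilbert_space \<Rightarrow>\<^sub>L 'b)) \<Rightarrow> bool" where
  "completely_positive_on M \<Phi> \<longleftrightarrow>
     (\<forall>n P. (\<forall>i<n. \<forall>j<n. P i j \<in> M) \<and> matrix_positive n P \<longrightarrow>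
        matrix_positive n (\<lambda>i j. \<Phi> (P i j)))"

definition cp_map ::
    "('a::chilbert_space \<Rightarrow>\<^sub>L 'a) set \<Rightarrow> ('b::chilbert_space \<Rightarrow>\<^sub>L 'b) set \<Rightarrow>
     (('a \<Rightarrow>\<^sub>L 'a) \<Rightarrow> ('b \<Rightarrow>\<^sub>L 'b)) \<Rightarrow> bool" where
  "cp_map M N \<Phi> \<longleftrightarrow>
     \<Phi> ` M \<subseteq> N \<and>
     (\<forall>A\<in>M. \<forall>B\<in>M. \<Phi> (A + B) = \<Phi> A + \<Phi> B) \<and>
     (\<forall>c. \<forall>A\<in>M. \<Phi> (op_scaleC c A) = op_scaleC c (\<Phi> A)) \<and>
     \<Phi> id_blinfun = id_blinfun \<and>
     completely_positive_on M \<Phi> \<and>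
     (\<forall>\<omega>. normal_state N \<omega> \<longrightarrow> normal_state M (\<lambda>A. \<omega> (\<Phi> A)))"


section \<open>Classical coding procedures\<close>

definition classical_coding_procedure ::
    "('k::chilbert_space \<Rightarrow>\<^sub>L 'k) set \<Rightarrow>
     (('k \<Rightarrow>\<^sub>L 'k) \<Rightarrow> ('h::chilbert_space \<Rightarrow>\<^sub>L 'h)) \<Rightarrow>
     (('h \<Rightarrow>\<^sub>L 'h) \<Rightarrow> ('k \<Rightarrow>\<^sub>L 'k)) \<Rightarrow> bool" where
  "classical_coding_procedure \<A> C D \<longleftrightarrow>
     von_neumann_algebra \<A> \<and> commutative_algebra \<A> \<and>
     cp_map \<A> bops C \<and> cp_map bops \<A> D"

text \<open>For unital positive \<open>C\<close> and \<open>D\<close> the set of norms is bounded (by 1), so the real supremum is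
  the intended one.\<close>

definition coding_imperfection ::
    "(('k::chilbert_space \<Rightarrow>\<^sub>L 'k) \<Rightarrow> ('h::chilbert_space \<Rightarrow>\<^sub>L 'h)) \<Rightarrow>
     (('h \<Rightarrow>\<^sub>L 'h) \<Rightarrow> ('k \<Rightarrow>\<^sub>L 'k)) \<Rightarrow> real" where
  "coding_imperfection C D =
     (SUP B\<in>{B \<in> bops. op_le 0 B \<and> op_le B id_blinfun}. norm (B - C (D B)))"

end

theory Submission
  imports Defs
begin

text \<open>Put \<open>T = C \<circ> D\<close> and \<open>Q v = \<langle>v, T(|v\<rangle>\<langle>v|) v\<rangle>\<close>. Testing the imperfection on rank one
  projections gives \<open>Q v \<ge> (1 - \<Delta>) \<parallel>v\<parallel>\<^sup>4\<close>. Let \<open>e a\<close> be an orthonormal basis. The phase vectors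
  \<open>\<psi> k = \<Sum>a. \<omega>^(k 2^a) e a\<close>, for \<open>\<omega>\<close> a root of unity of large order \<open>N\<close>, together with the basis
  vectors form a 2-design, so
  \<open>(d\<^sup>2 + d) (1 - \<Delta>) \<le> (1 / N) (\<Sum>k. Q (\<psi> k)) + (\<Sum>a. Q (e a)) = d + S\<close>, where
  \<open>S = \<Sum>a c. \<langle>e a, T(|e a\<rangle>\<langle>e c|) e c\<rangle>\<close>. A positive matrix \<open>X\<close> with entries in a commutative
  algebra satisfies \<open>X \<le> tr X \<cdot> 1\<close>, as does a positive scalar matrix; applying \<open>C\<close> to this inequality
  for \<open>X a c = D(|e a\<rangle>\<langle>e c|)\<close> gives \<open>S \<le> d\<close>, and hence \<open>1 - \<Delta> \<le> 2 / (d + 1)\<close>.\<close>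

section \<open>Inner product identities and the Cauchy-Schwarz inequality\<close>

lemma cinner_add_left: "cinner (x + y) z = cinner x z + cinner (y :: 'a::chilbert_space) z"
  by (metis cinner_add_right cinner_commute complex_cnj_add)

lemma cinner_scaleC_left: "cinner (c *\<^sub>C x) y = cnj c * cinner (x :: 'a::chilbert_space) y"
  by (metis cinner_commute cinner_scaleC_right complex_cnj_mult)

lemma cinner_scaleR_right: "cinner x (r *\<^sub>R y) = of_real r * cinner x (y :: 'a::chilbert_space)"
  by (metis cinner_scaleC_right scaleC_of_real)

lemma cinner_scaleR_left: "cinner (r *\<^sub>R x) y = of_real r * cinner (x :: 'a::chilbert_space) y"
  by (metis cinner_scaleC_left complex_cnj_complex_of_real scaleC_of_real)

lemma cinner_minus_right: "cinner x (- y) = - cinner x (y :: 'a::chilbert_space)"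
  using cinner_scaleR_right[of x "-1" y] by simp

lemma cinner_minus_left: "cinner (- x) y = - cinner x (y :: 'a::chilbert_space)"
  using cinner_scaleR_left[of "-1" x y] by simp

lemma cinner_diff_right: "cinner x (y - z) = cinner x y - cinner x (z :: 'a::chilbert_space)"
  using cinner_add_right[of x y "- z"] by (simp add: cinner_minus_right)

lemma cinner_diff_left: "cinner (x - y) z = cinner x z - cinner y (z :: 'a::chilbert_space)"
  using cinner_add_left[of x "- y" z] by (simp add: cinner_minus_left)

lemma cinner_zero_right [simp]: "cinner x (0 :: 'a::chilbert_space) = 0"
  using cinner_scaleR_right[of x 0 0] by simp

lemma cinner_zero_left [simp]: "cinner (0 :: 'a::chilbert_space) x = 0"
  using cinner_scaleR_left[of 0 0 x] by simp

lemmas cinner_simps = cinner_add_left cinner_add_right cinner_diff_left cinner_diff_right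
  cinner_scaleC_left cinner_scaleC_right cinner_scaleR_left cinner_scaleR_right
  cinner_minus_left cinner_minus_right

lemma cinner_sum_right:
  "cinner x (\<Sum>i\<in>I. f i) = (\<Sum>i\<in>I. cinner x (f i :: 'a::chilbert_space))"
  by (induction I rule: infinite_finite_induct) (simp_all add: cinner_add_right)

lemma cinner_sum_left:
  "cinner (\<Sum>i\<in>I. f i) x = (\<Sum>i\<in>I. cinner (f i :: 'a::chilbert_space) x)"
  by (induction I rule: infinite_finite_induct) (simp_all add: cinner_add_left)

lemma cinner_self: "cinner x x = of_real ((norm (x :: 'a::chilbert_space))\<^sup>2)"
proof -
  have "Im (cinner x x) = 0" and "Re (cinner x x) \<ge> 0"
    using cinner_self_nonneg[of x] by (simp_all add: complex_nonneg_Reals_iff)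
  then show ?thesis
    by (simp add: complex_eq_iff norm_eq_sqrt_cinner del: of_real_power)
qed

lemma Re_cinner_commute: "Re (cinner x y) = Re (cinner (y :: 'a::chilbert_space) x)"
  using cinner_commute[of x y] by simp

lemma norm_add_sqr:
  "(norm (x + y))\<^sup>2 = (norm x)\<^sup>2 + 2 * Re (cinner x y) + (norm (y :: 'a::chilbert_space))\<^sup>2"
proof -
  have "cinner (x + y) (x + y) = cinner x x + cinner x y + cinner y x + cinner y y"
    by (simp add: cinner_simps)
  then have "Re (cinner (x + y) (x + y)) = Re (cinner x x + cinner x y + cinner y x + cinner y y)"
    by simp
  then show ?thesis
    unfolding cinner_self by (simp add: Re_cinner_commute[of y x] del: of_real_power)
qed

text \<open>The triangle inequality is an axiom of the normed structure here, so the Cauchy-Schwarz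
  inequality is read off from it by expanding the square.\<close>

lemma Re_cinner_le: "Re (cinner x y) \<le> norm x * norm (y :: 'a::chilbert_space)"
proof -
  have "(norm (x + y))\<^sup>2 \<le> (norm x + norm y)\<^sup>2"
    by (intro power_mono norm_triangle_ineq) simp
  then show ?thesis
    unfolding norm_add_sqr by (simp add: power2_sum)
qed

lemma norm_cinner_le: "cmod (cinner x y) \<le> norm x * norm (y :: 'a::chilbert_space)"
proof -
  define c where "c = cnj (sgn (cinner x y))"
  \<comment> \<open>Only an inequality: \<open>sgn 0 = 0\<close> makes \<open>c\<close> vanish
    together with the inner product.\<close>
  have "cmod c \<le> 1"
    by (simp add: c_def norm_sgn)
  have "c * cinner x y = of_real (cmod (cinner x y))"
    by (cases "cinner x y = 0")
      (simp_all add: c_def sgn_div_norm complex_norm_square[symmetric] power2_eq_square mult.commute[of "cnj _"]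
        divide_simps scaleR_conv_of_real)
  then have "cmod (cinner x y) = Re (cinner x (c *\<^sub>C y))"
    by (simp add: cinner_simps)
  also have "\<dots> \<le> norm x * (cmod c * norm y)"
    by (metis Re_cinner_le norm_scaleC)
  also have "\<dots> \<le> norm x * norm y"
    using \<open>cmod c \<le> 1\<close> by (intro mult_left_mono mult_left_le_one_le) auto
  finally show ?thesis .
qed

section \<open>Rank one operators and closure properties of \<open>bops\<close>\<close>

definition rank_one :: "'a::chilbert_space \<Rightarrow> 'a \<Rightarrow> ('a \<Rightarrow>\<^sub>L 'a)" where
  "rank_one x y = Blinfun (\<lambda>z. cinner y z *\<^sub>C x)"

lemma rank_one_apply [simp]: "blinfun_apply (rank_one x y) z = cinner y z *\<^sub>C x"
  unfolding rank_one_def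
proof (subst bounded_linear_Blinfun_apply, rule bounded_linear_intro[where K = "norm y * norm x"])
  show "cinner y (r *\<^sub>R z) *\<^sub>C x = r *\<^sub>R cinner y z *\<^sub>C x" for r z
    by (simp add: cinner_simps scaleC_of_real[symmetric] scaleC_scaleC)
  show "norm (cinner y z *\<^sub>C x) \<le> norm z * (norm y * norm x)" for z
    using mult_right_mono[OF norm_cinner_le[of y z], of "norm x"]
    by (simp add: norm_scaleC mult_ac)
qed (simp_all add: cinner_simps scaleC_add_left)

lemma in_bopsD: "A \<in> bops \<Longrightarrow> blinfun_apply A (c *\<^sub>C x) = c *\<^sub>C blinfun_apply A x"
  by (simp add: bops_def)

lemma scaleC_commute: "c *\<^sub>C c' *\<^sub>C x = c' *\<^sub>C c *\<^sub>C (x :: 'a::chilbert_space)"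
  by (simp add: scaleC_scaleC mult.commute)

lemma scaleC_scaleR_commute: "c *\<^sub>C r *\<^sub>R x = r *\<^sub>R c *\<^sub>C (x :: 'a::chilbert_space)"
  by (metis scaleC_commute scaleC_of_real)

lemma scaleC_zero_right [simp]: "c *\<^sub>C (0 :: 'a::chilbert_space) = 0"
  by (rule module.scale_zero_right) (rule vector_space_scaleC[unfolded vector_space_def module_def[symmetric]])

lemma scaleC_zero_left [simp]: "0 *\<^sub>C (x :: 'a::chilbert_space) = 0"
  using scaleC_of_real[of 0 x] by simp

lemma zero_in_bops [simp]: "0 \<in> bops"
  by (simp add: bops_def)

lemma id_in_bops [simp]: "id_blinfun \<in> bops"
  by (simp add: bops_def)

lemma add_in_bops [simp]: "A \<in> bops \<Longrightarrow> B \<in> bops \<Longrightarrow> A + B \<in> bops"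
  by (simp add: bops_def blinfun.add_left scaleC_add_right)

lemma scaleR_in_bops [simp]: "A \<in> bops \<Longrightarrow> r *\<^sub>R A \<in> bops"
  by (simp add: bops_def blinfun.scaleR_left scaleC_scaleR_commute)

lemma op_scaleC_in_bops [simp]: "A \<in> bops \<Longrightarrow> op_scaleC c A \<in> bops"
  by (simp add: bops_def scaleC_commute)

lemma rank_one_in_bops [simp]: "rank_one x y \<in> bops"
  by (simp add: bops_def cinner_simps scaleC_scaleC)

lemma op_scaleC_zero [simp]: "op_scaleC 0 A = 0"
  by (rule blinfun_eqI) simp

lemma op_scaleC_minus_one: "op_scaleC (- 1) A = - A"
proof (rule blinfun_eqI)
  show "blinfun_apply (op_scaleC (- 1) A) x = blinfun_apply (- A) x" for x
    using scaleC_of_real[of "-1" "blinfun_apply A x"] by (simp add: blinfun.minus_left)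
qed

lemma uminus_in_bops [simp]: "A \<in> bops \<Longrightarrow> - A \<in> bops"
  by (metis op_scaleC_in_bops op_scaleC_minus_one)

lemma diff_in_bops [simp]: "A \<in> bops \<Longrightarrow> B \<in> bops \<Longrightarrow> A - B \<in> bops"
  using add_in_bops[of A "- B"] by simp

lemma sum_in_bops [simp]: "(\<And>i. i \<in> I \<Longrightarrow> f i \<in> bops) \<Longrightarrow> (\<Sum>i\<in>I. f i) \<in> bops"
  by (induction I rule: infinite_finite_induct) simp_all

section \<open>Positive forms of operators and of 2 by 2 operator blocks\<close>

lemma nonneg_Reals_iff: "z \<in> \<real>\<^sub>\<ge>\<^sub>0 \<longleftrightarrow> Im z = 0 \<and> Re z \<ge> 0"
  by (auto simp: complex_nonneg_Reals_iff)

lemma sum_in_nonneg_Reals: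
  "(\<And>i. i \<in> I \<Longrightarrow> f i \<in> \<real>\<^sub>\<ge>\<^sub>0) \<Longrightarrow> (\<Sum>i\<in>I. f i :: complex) \<in> \<real>\<^sub>\<ge>\<^sub>0"
  by (simp add: nonneg_Reals_iff sum_nonneg)

text \<open>Polarization: replacing \<open>y\<close> by \<open>\<i> *\<^sub>C y\<close> turns the
  hypothesis on imaginary parts into one on real parts. With \<open>q = q'\<close> it gives the
  symmetry of an operator with real form.\<close>

lemma symmetric_form_off_diagonal:
  assumes "q \<in> bops" "q' \<in> bops"
    and "\<And>x y. Im (cinner x (blinfun_apply q y) + cinner y (blinfun_apply q' x)) = 0"
  shows "cinner (blinfun_apply q' x) y = cinner x (blinfun_apply q y)"
proof -
  have "Im (cinner x (blinfun_apply q y) + cinner y (blinfun_apply q' x)) = 0"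
    using assms(3) .
  moreover have "Im (\<i> * cinner x (blinfun_apply q y) - \<i> * cinner y (blinfun_apply q' x)) = 0"
    using assms(3)[of x "\<i> *\<^sub>C y"] by (simp add: in_bopsD assms cinner_simps)
  ultimately have "cinner x (blinfun_apply q y) = cnj (cinner y (blinfun_apply q' x))"
    by (simp add: complex_eq_iff)
  then show ?thesis
    using cinner_commute[of "blinfun_apply q' x" y] by simp
qed

lemma real_form_symmetric:
  assumes "A \<in> bops" and real: "\<And>x. Im (cinner x (blinfun_apply A x)) = 0"
  shows "cinner (blinfun_apply A x) y = cinner x (blinfun_apply A y)"
proof (rule symmetric_form_off_diagonal[OF assms(1,1)])
  show "Im (cinner x (blinfun_apply A y) + cinner y (blinfun_apply A x)) = 0" for x y
    using real[of "x + y"] real[of x] real[of y]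
    by (simp add: blinfun.add_right cinner_simps)
qed

text \<open>Polarization at \<open>x + B x\<close> and \<open>x - B x\<close> replaces the square
  root of \<open>B\<close>: the difference of the two form values is four times the squared norm of
  \<open>B x\<close>, the first is at most the squared norm of \<open>x + B x\<close>, and the
  second is nonnegative.\<close>

lemma norm_le_1_if_op_le_id:
  assumes B: "B \<in> bops" and "op_le 0 B" "op_le B id_blinfun"
  shows "norm B \<le> 1"
proof (rule norm_blinfun_bound)
  fix x
  let ?f = "\<lambda>x. cinner x (blinfun_apply B x)"
  let ?y = "blinfun_apply B x"
  have pos: "Im (?f x) = 0" "0 \<le> Re (?f x)" for x
    using assms(2) by (simp_all add: op_le_def op_positive_def nonneg_Reals_iff)
  have le: "Re (?f x) \<le> (norm x)\<^sup>2" for x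
    using assms(3)
    by (simp add: op_le_def op_positive_def nonneg_Reals_iff blinfun.diff_left cinner_simps
        cinner_self del: of_real_power)
  have sym: "cinner (blinfun_apply B x) y = cinner x (blinfun_apply B y)" for x y
    using B pos(1) by (rule real_form_symmetric)
  have "?f (x + ?y) - ?f (x - ?y) = 2 * (cinner x (blinfun_apply B ?y) + cinner ?y ?y)"
    by (simp add: blinfun.add_right blinfun.diff_right cinner_simps)
  also have "\<dots> = of_real (4 * (norm ?y)\<^sup>2)"
    by (simp add: sym[symmetric] cinner_self)
  finally have "Re (?f (x + ?y) - ?f (x - ?y)) = 4 * (norm ?y)\<^sup>2"
    by (metis Re_complex_of_real)
  then have "4 * (norm ?y)\<^sup>2 \<le> (norm (x + ?y))\<^sup>2"
    using pos(2)[of "x - ?y"] le[of "x + ?y"] by simp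
  also have "\<dots> \<le> (norm x + norm ?y)\<^sup>2"
    by (intro power_mono norm_triangle_ineq) simp
  finally have "(2 * norm ?y)\<^sup>2 \<le> (norm x + norm ?y)\<^sup>2"
    by (simp add: power_mult_distrib)
  then have "2 * norm ?y \<le> norm x + norm ?y"
    by (rule power2_le_imp_le) simp
  then show "norm ?y \<le> 1 * norm x"
    by simp
qed simp

text \<open>Lax--Milgram: for small \<open>s\<close> the map \<open>u \<mapsto> u - s (A u - x)\<close> is a contraction.\<close>

lemma coercive_surj:
  fixes A :: "'a::chilbert_space \<Rightarrow>\<^sub>L 'a"
  assumes "\<epsilon> > 0" and coercive: "\<And>x. \<epsilon> * (norm x)\<^sup>2 \<le> Re (cinner x (blinfun_apply A x))"
  shows "surj (blinfun_apply A)"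
proof -
  \<comment> \<open>This \<open>s\<close> minimizes
    \<open>1 - 2 * s * \<epsilon> + s\<^sup>2 * K\<^sup>2\<close>, and the minimum is
    \<open>c\<^sup>2\<close>. Adding \<epsilon> to the norm ensures \<open>K > 0\<close> and
    \<open>\<epsilon> \<le> K\<close>, so that the root defining \<open>c\<close> is real.\<close>
  define K where "K = norm A + \<epsilon>"
  define s where "s = \<epsilon> / K\<^sup>2"
  define c where "c = sqrt (1 - (\<epsilon> / K)\<^sup>2)"
  have K: "K > 0" "\<epsilon> \<le> K"
    using \<open>\<epsilon> > 0\<close> by (simp_all add: K_def add_nonneg_pos)
  then have s: "s > 0"
    using \<open>\<epsilon> > 0\<close> by (simp add: s_def)
  have "(\<epsilon> / K)\<^sup>2 \<le> 1" "(\<epsilon> / K)\<^sup>2 > 0"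
    using K \<open>\<epsilon> > 0\<close> by (simp_all add: power_le_one)
  then have c: "0 \<le> c" "c < 1" "c\<^sup>2 = 1 - (\<epsilon> / K)\<^sup>2"
    by (simp_all add: c_def)
  have contr: "norm (v - s *\<^sub>R blinfun_apply A v) \<le> c * norm v" for v
  proof (rule power2_le_imp_le)
    have "norm (blinfun_apply A v) \<le> norm A * norm v"
      by (rule norm_blinfun)
    also have "\<dots> \<le> K * norm v"
      using \<open>\<epsilon> > 0\<close> by (intro mult_right_mono) (simp_all add: K_def)
    finally have *: "(norm (blinfun_apply A v))\<^sup>2 \<le> K\<^sup>2 * (norm v)\<^sup>2"
      by (metis power_mono norm_ge_zero power_mult_distrib)
    have "(norm (v - s *\<^sub>R blinfun_apply A v))\<^sup>2
        = (norm v)\<^sup>2 - 2 * s * Re (cinner v (blinfun_apply A v)) + s\<^sup>2 * (norm (blinfun_apply A v))\<^sup>2"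
      using norm_add_sqr[of v "- (s *\<^sub>R blinfun_apply A v)"] 
      by (simp add: cinner_simps power_mult_distrib)
    also have "\<dots> \<le> (norm v)\<^sup>2 - 2 * s * (\<epsilon> * (norm v)\<^sup>2) + s\<^sup>2 * (K\<^sup>2 * (norm v)\<^sup>2)"
      using s * coercive[of v] by (intro add_mono diff_mono mult_left_mono) simp_all
    also have "\<dots> = (c * norm v)\<^sup>2"
      using K unfolding power_mult_distrib c(3) by (simp add: s_def field_simps power2_eq_square)
    finally show "(norm (v - s *\<^sub>R blinfun_apply A v))\<^sup>2 \<le> (c * norm v)\<^sup>2" .
  qed (use c in simp)
  show ?thesis
    unfolding surj_def
  proof
    fix x
    let ?g = "\<lambda>u. u - s *\<^sub>R (blinfun_apply A u - x)"
    have "\<exists>!u. ?g u = u"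
      using c(1,2)
    proof (rule banach_fix_type)
      show "\<forall>u v. dist (?g u) (?g v) \<le> c * dist u v"
      proof (intro allI)
        show "dist (?g u) (?g v) \<le> c * dist u v" for u v
          using contr[of "u - v"] by (simp add: dist_norm blinfun.diff_right algebra_simps)
      qed
    qed
    then show "\<exists>u. x = blinfun_apply A u"
      using s by auto
  qed
qed

text \<open>Solving \<open>P u = x\<close> turns the claim into a sum of the hypothesis at \<open>(- q u, P u)\<close> and the
  value of the form of \<open>P\<close> at \<open>q' u + y\<close>.\<close>

lemma positive_block_swap_surj:
  fixes P q q' r :: "'a::chilbert_space \<Rightarrow>\<^sub>L 'a"
  assumes "q \<in> bops" "q' \<in> bops" and "P \<in> bops" and "surj (blinfun_apply P)"
    and Pq: "\<And>x. blinfun_apply P (blinfun_apply q x) = blinfun_apply q (blinfun_apply P x)"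
    and Pq': "\<And>x. blinfun_apply P (blinfun_apply q' x) = blinfun_apply q' (blinfun_apply P x)"
    and qq': "\<And>x. blinfun_apply q (blinfun_apply q' x) = blinfun_apply q' (blinfun_apply q x)"
    and pos: "\<And>x y. cinner x (blinfun_apply P x) + cinner x (blinfun_apply q y)
      + cinner y (blinfun_apply q' x) + cinner y (blinfun_apply r y) \<in> \<real>\<^sub>\<ge>\<^sub>0"
  shows "cinner x (blinfun_apply r x) + cinner x (blinfun_apply q y)
      + cinner y (blinfun_apply q' x) + cinner y (blinfun_apply P y) \<in> \<real>\<^sub>\<ge>\<^sub>0"
proof -
  have P_pos: "cinner v (blinfun_apply P v) \<in> \<real>\<^sub>\<ge>\<^sub>0" for v
    using pos[of v 0] by simp
  have r_pos: "cinner v (blinfun_apply r v) \<in> \<real>\<^sub>\<ge>\<^sub>0" for v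
    using pos[of 0 v] by simp
  have adj: "cinner (blinfun_apply q' v) w = cinner v (blinfun_apply q w)" for v w
  proof (rule symmetric_form_off_diagonal[OF assms(1,2)])
    show "Im (cinner v (blinfun_apply q w) + cinner w (blinfun_apply q' v)) = 0" for v w
      using pos[of v w] P_pos[of v] r_pos[of w] by (simp add: nonneg_Reals_iff)
  qed
  have adj': "cinner (blinfun_apply q v) w = cinner v (blinfun_apply q' w)" for v w
    using adj[of w v] by (metis cinner_commute)
  have P_sym: "cinner (blinfun_apply P v) w = cinner v (blinfun_apply P w)" for v w
    using assms(3) by (rule real_form_symmetric) (use P_pos in \<open>simp add: nonneg_Reals_iff\<close>)
  obtain u where u: "x = blinfun_apply P u"
    using \<open>surj (blinfun_apply P)\<close> by (metis surjD)
  \<comment> \<open>The terms with \<open>q\<close> or \<open>P\<close> at \<open>(?v, x)\<close>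
    add up to \<open>- <x, q' (q u)>\<close>. By commutativity this cancels
    \<open><q' u, P (q' u)>\<close> in the form at \<open>?w\<close>, whose cross terms become the
    two off-diagonal terms of the claim.\<close>
  let ?v = "- blinfun_apply q u" and ?w = "blinfun_apply q' u + y"
  have "cinner x (blinfun_apply r x) + cinner x (blinfun_apply q y)
      + cinner y (blinfun_apply q' x) + cinner y (blinfun_apply P y)
      = (cinner ?v (blinfun_apply P ?v) + cinner ?v (blinfun_apply q x)
      + cinner x (blinfun_apply q' ?v) + cinner x (blinfun_apply r x))
      + cinner ?w (blinfun_apply P ?w)"
    by (simp add: u cinner_simps blinfun.add_right blinfun.minus_right adj adj' P_sym Pq Pq' qq')
  also have "\<dots> \<in> \<real>\<^sub>\<ge>\<^sub>0"
    by (intro nonneg_Reals_add_I pos P_pos)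
  finally show ?thesis .
qed

text \<open>Fails without commutativity, like the positivity of the transposed matrix.\<close>

lemma positive_block_swap:
  fixes p q q' r :: "'a::chilbert_space \<Rightarrow>\<^sub>L 'a"
  assumes bops: "q \<in> bops" "q' \<in> bops" "p \<in> bops"
    and comm: "p o\<^sub>L q = q o\<^sub>L p" "p o\<^sub>L q' = q' o\<^sub>L p" "q o\<^sub>L q' = q' o\<^sub>L q"
    and pos: "\<And>x y. cinner x (blinfun_apply p x) + cinner x (blinfun_apply q y)
      + cinner y (blinfun_apply q' x) + cinner y (blinfun_apply r y) \<in> \<real>\<^sub>\<ge>\<^sub>0"
  shows "cinner x (blinfun_apply r x) + cinner x (blinfun_apply q y)
      + cinner y (blinfun_apply q' x) + cinner y (blinfun_apply p y) \<in> \<real>\<^sub>\<ge>\<^sub>0"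
proof -
  let ?N = "cinner x (blinfun_apply r x) + cinner x (blinfun_apply q y)
      + cinner y (blinfun_apply q' x) + cinner y (blinfun_apply p y)"
  have comm': "blinfun_apply p (blinfun_apply q v) = blinfun_apply q (blinfun_apply p v)"
    "blinfun_apply p (blinfun_apply q' v) = blinfun_apply q' (blinfun_apply p v)"
    "blinfun_apply q (blinfun_apply q' v) = blinfun_apply q' (blinfun_apply q v)" for v
    using comm by (metis blinfun_apply_blinfun_compose)+
  have p_pos: "cinner v (blinfun_apply p v) \<in> \<real>\<^sub>\<ge>\<^sub>0" for v
    using pos[of v 0] by simp
  \<comment> \<open>\<open>p\<close> need not be onto, but \<open>p + \<epsilon>\<close> is
    coercive, hence onto, and it inherits the commutation and positivity hypotheses.\<close>
  have *: "?N + of_real (\<epsilon> * (norm y)\<^sup>2) \<in> \<real>\<^sub>\<ge>\<^sub>0" if "\<epsilon> > 0" for \<epsilon> :: real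
  proof -
    define P where "P = p + \<epsilon> *\<^sub>R id_blinfun"
    have P: "blinfun_apply P v = blinfun_apply p v + \<epsilon> *\<^sub>R v" for v :: 'a
      by (simp add: P_def blinfun.add_left blinfun.scaleR_left)
    have form: "cinner v (blinfun_apply P v) = cinner v (blinfun_apply p v)
        + of_real (\<epsilon> * (norm v)\<^sup>2)" for v :: 'a
      by (simp add: P cinner_simps cinner_self)
    have "cinner x (blinfun_apply r x) + cinner x (blinfun_apply q y)
      + cinner y (blinfun_apply q' x) + cinner y (blinfun_apply P y) \<in> \<real>\<^sub>\<ge>\<^sub>0"
    proof (rule positive_block_swap_surj[OF bops(1,2)])
      show "P \<in> bops"
        by (simp add: P_def bops)
      show "surj (blinfun_apply P)"
        using \<open>\<epsilon> > 0\<close>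
      proof (rule coercive_surj)
        show "\<epsilon> * (norm v)\<^sup>2 \<le> Re (cinner v (blinfun_apply P v))" for v :: 'a
          using p_pos[of v] unfolding form by (simp add: nonneg_Reals_iff del: of_real_mult of_real_power)
      qed
    next
      fix v w :: 'a
      have "0 \<le> \<epsilon> * (norm v)\<^sup>2"
        using \<open>\<epsilon> > 0\<close> by simp
      then show "cinner v (blinfun_apply P v) + cinner v (blinfun_apply q w)
          + cinner w (blinfun_apply q' v) + cinner w (blinfun_apply r w) \<in> \<real>\<^sub>\<ge>\<^sub>0"
        using pos[of v w] unfolding form
        by (simp add: nonneg_Reals_iff del: of_real_mult of_real_power)
    qed (simp_all add: P comm' blinfun.add_right blinfun.scaleR_right)
    then show ?thesis
      by (simp add: form add.assoc)
  qed
  have "((\<lambda>\<epsilon>. Re (?N + of_real (\<epsilon> * (norm y)\<^sup>2))) \<longlongrightarrow> Re (?N + of_real (0 * (norm y)\<^sup>2))) (at_right 0)"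
    by (intro tendsto_intros)
  moreover have "\<forall>\<^sub>F \<epsilon> in at_right 0. 0 \<le> Re (?N + of_real (\<epsilon> * (norm y)\<^sup>2))"
    using eventually_at_right_less[of 0]
    by eventually_elim (use * in \<open>simp add: nonneg_Reals_iff del: of_real_mult of_real_power\<close>)
  ultimately have "0 \<le> Re (?N + of_real (0 * (norm y)\<^sup>2))"
    by (intro tendsto_lowerbound) auto
  \<comment> \<open>The limit gives the real part. The perturbation is real, so a single \<epsilon>
    settles the imaginary part.\<close>
  then show ?thesis
    using *[of 1] by (simp add: nonneg_Reals_iff del: of_real_mult of_real_power)
qed

section \<open>Orthonormal bases in finite dimension\<close>

text \<open>Instead of the Gram-Schmidt process, take an orthonormal set of maximal cardinality:
  orthonormal sets are independent, so \<open>card E\<close> bounds their size. A vector differing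
  from its expansion would leave a residual that, once normalized, enlarges the set.\<close>

lemma orthonormal_basis_exists:
  fixes E :: "'h::chilbert_space set"
  assumes "finite_dimensional_vector_space (scaleC :: complex \<Rightarrow> 'h \<Rightarrow> 'h) E"
    and "vector_space.dim (scaleC :: complex \<Rightarrow> 'h \<Rightarrow> 'h) UNIV = d"
  obtains e :: "nat \<Rightarrow> 'h" where "\<And>i j. i < d \<Longrightarrow> j < d \<Longrightarrow> cinner (e i) (e j) = of_bool (i = j)"
    and "\<And>v. v = (\<Sum>i<d. cinner (e i) v *\<^sub>C e i)"
proof -
  interpret V: finite_dimensional_vector_space "scaleC :: complex \<Rightarrow> 'h \<Rightarrow> 'h" E
    by fact
  define orthonormal :: "'h set \<Rightarrow> bool" where
    "orthonormal B \<longleftrightarrow> finite B \<and> (\<forall>x\<in>B. \<forall>y\<in>B. cinner x y = of_bool (x = y))" for B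
  have coeff: "cinner b (\<Sum>x\<in>B. f x *\<^sub>C x) = f b" if "orthonormal B" "b \<in> B" for B b f
  proof -
    have "cinner b (\<Sum>x\<in>B. f x *\<^sub>C x) = (\<Sum>x\<in>B. f x * of_bool (b = x))"
      using that by (simp add: cinner_sum_right cinner_scaleC_right orthonormal_def)
    also have "\<dots> = f b"
      using that by (simp add: orthonormal_def)
    finally show ?thesis .
  qed
  have independent: "V.independent B" if "orthonormal B" for B
  proof (rule V.independent_if_scalars_zero)
    show "finite B"
      using that by (simp add: orthonormal_def)
    show "f b = 0" if "(\<Sum>x\<in>B. f x *\<^sub>C x) = 0" "b \<in> B" for f b
      using coeff[OF \<open>orthonormal B\<close> that(2), of f] that(1) by simp
  qed
  have "orthonormal {}"
    by (simp add: orthonormal_def)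
  moreover have "\<forall>B. orthonormal B \<longrightarrow> card B \<le> card E"
    using independent V.independent_span_bound[OF V.finite_Basis] by (auto simp: V.span_Basis)
  ultimately obtain B where B: "orthonormal B" and max: "\<And>B'. orthonormal B' \<Longrightarrow> card B' \<le> card B"
    using ex_has_greatest_nat[of orthonormal "{}" card "Suc (card E)"] by (auto simp: less_Suc_eq_le)
  have fin: "finite B"
    using B by (simp add: orthonormal_def)
  have expand: "v = (\<Sum>b\<in>B. cinner b v *\<^sub>C b)" for v
  proof (rule ccontr)
    define w where "w = v - (\<Sum>b\<in>B. cinner b v *\<^sub>C b)"
    define n where "n = (1 / norm w) *\<^sub>R w"
    assume "v \<noteq> (\<Sum>b\<in>B. cinner b v *\<^sub>C b)"
    then have "w \<noteq> 0"
      by (simp add: w_def)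
    then have n1: "cinner n n = 1"
      by (simp add: n_def cinner_self)
    have "cinner b w = 0" if "b \<in> B" for b
      by (simp add: w_def cinner_diff_right coeff[OF B that])
    then have bn: "cinner b n = 0" if "b \<in> B" for b
      using that by (simp add: n_def cinner_scaleR_right)
    then have nb: "cinner n b = 0" if "b \<in> B" for b
      using that cinner_commute[of n b] by simp
    have "n \<notin> B"
      using bn n1 by force
    have "orthonormal (insert n B)"
      using B n1 nb bn \<open>n \<notin> B\<close> by (auto simp: orthonormal_def)
    then have "card (insert n B) \<le> card B"
      by (rule max)
    then show False
      using fin \<open>n \<notin> B\<close> by simp
  qed
  have "V.span B = V.span UNIV"
  proof -
    have "v \<in> V.span B" for v
      by (subst expand) (intro V.span_sum V.span_scale V.span_base)
    then show ?thesis
      by auto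
  qed
  then have "card B = d"
    using V.dim_eq_card[OF _ independent[OF B]] assms(2) by metis
  then obtain e where e: "bij_betw e {..<d} B"
    using fin by (metis bij_betw_from_nat_into_finite)
  show thesis
  proof (rule that)
    show "cinner (e i) (e j) = of_bool (i = j)" if "i < d" "j < d" for i j
    proof -
      have "e i \<in> B" "e j \<in> B" "e i = e j \<longleftrightarrow> i = j"
        using e that by (auto simp: bij_betw_def inj_on_eq_iff)
      then show ?thesis
        using B by (simp add: orthonormal_def)
    qed
    show "v = (\<Sum>i<d. cinner (e i) v *\<^sub>C e i)" for v
      using expand[of v] sum.reindex_bij_betw[OF e, of "\<lambda>b. cinner b v *\<^sub>C b"] by simp
  qed
qed

section \<open>Averaging over phases\<close>

text \<open>The larger exponents must agree, since \<open>i \<le> j < l\<close> gives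
  \<open>2 ^ i + 2 ^ j \<le> 2 ^ Suc j \<le> 2 ^ l\<close>. Cancelling them leaves the smaller
  ones.\<close>

lemma sum_of_two_powers_eq_iff:
  fixes a b c g :: nat
  shows "2 ^ b + 2 ^ g = (2 ^ a + 2 ^ c :: nat) \<longleftrightarrow> (a = b \<and> c = g) \<or> (a = g \<and> c = b)"
proof
  have less: "2 ^ i + 2 ^ j < (2 ^ k + 2 ^ l :: nat)" if "i \<le> j" "j < l" for i j k l :: nat
  proof -
    have "(2::nat) ^ i \<le> 2 ^ j" "(2::nat) ^ Suc j \<le> 2 ^ l"
      using that by (intro power_increasing; simp)+
    moreover have "(0::nat) < 2 ^ k"
      by simp
    ultimately show ?thesis
      unfolding power_Suc by linarith
  qed
  have ordered: "i = k \<and> j = l" if eq: "2 ^ i + 2 ^ j = (2 ^ k + 2 ^ l :: nat)" and "i \<le> j" "k \<le> l"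
    for i j k l :: nat
  proof -
    have "j = l"
      using less[of i j l k] less[of k l j i] that by (metis nat_neq_iff)
    then show ?thesis
      using eq by simp
  qed
  assume "2 ^ b + 2 ^ g = (2 ^ a + 2 ^ c :: nat)"
  then show "(a = b \<and> c = g) \<or> (a = g \<and> c = b)"
    using ordered[of b g a c] ordered[of g b a c] ordered[of b g c a] ordered[of g b c a]
    by (metis add.commute nat_le_linear)
qed auto

text \<open>A geometric sum of an \<open>N\<close>-th root of unity. The conjugate plays the inverse
  of \<omega>, and exponents below \<open>N\<close> cannot agree modulo \<open>N\<close> without
  being equal.\<close>

lemma sum_root_of_unity_powers:
  fixes \<omega> :: complex
  assumes "s < N" "t < N" and \<omega>: "\<omega> = cis (2 * pi / real N)"
  shows "(\<Sum>k<N. (\<omega> ^ s * cnj \<omega> ^ t) ^ k) = of_nat N * of_bool (s = t)"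
proof -
  define \<zeta> where "\<zeta> = \<omega> ^ s * cnj \<omega> ^ t"
  have "N > 0"
    using assms by simp
  have unit: "\<omega> * cnj \<omega> = 1"
    by (simp add: \<omega> cis_cnj cis_mult)
  have "\<omega> ^ N = 1"
    using \<open>N > 0\<close> by (simp add: \<omega> Complex.DeMoivre)
  then have "cnj \<omega> ^ N = 1"
    by (metis complex_cnj_one complex_cnj_power)
  then have N: "\<zeta> ^ N = 1"
    using \<open>\<omega> ^ N = 1\<close>
    by (simp add: \<zeta>_def power_mult_distrib power_mult[symmetric] mult.commute[of _ N])
      (simp add: power_mult)
  show ?thesis
  proof (cases "s = t")
    case True
    then have "\<omega> ^ s * cnj \<omega> ^ t = 1"
      by (simp add: power_mult_distrib[symmetric] unit)
    then show ?thesis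
      using True by simp
  next
    case False
    have "\<zeta> \<noteq> 1"
    proof
      assume "\<zeta> = 1"
      then have "\<omega> ^ s = \<omega> ^ t"
        by (simp add: \<zeta>_def) (metis mult.assoc mult.commute mult.right_neutral power_mult_distrib power_one unit)
      moreover have "inj_on (\<lambda>k. cis (2 * pi * real k / real N)) {..<N}"
        using Complex.bij_betw_roots_unity[OF \<open>N > 0\<close>] by (rule bij_betw_imp_inj_on)
      moreover have "\<omega> ^ k = cis (2 * pi * real k / real N)" for k
        by (simp add: \<omega> Complex.DeMoivre mult_ac)
      ultimately show False
        using False assms by (metis inj_onD lessThan_iff)
    qed
    then have "(\<Sum>k<N. \<zeta> ^ k) = 0"
      using N by (simp add: geometric_sum)
    then show ?thesis
      using False by (simp add: \<zeta>_def)
  qed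
qed

text \<open>Powers of 2 form a Sidon set, so only the terms with \<open>{a, c} = {b, g}\<close> survive; those with all
  indices equal are counted by both double sums.\<close>

lemma sum_phase_average:
  fixes t :: "nat \<Rightarrow> nat \<Rightarrow> nat \<Rightarrow> nat \<Rightarrow> complex" and d :: nat
  defines "N \<equiv> 2 * 2 ^ d + 1 :: nat"
  defines "z \<equiv> (\<lambda>k a. cis (2 * pi / real N) ^ (2 ^ a * k))"
  shows "(\<Sum>k<N. \<Sum>a<d. \<Sum>b<d. \<Sum>c<d. \<Sum>g<d. cnj (z k a) * z k b * cnj (z k c) * z k g * t a b c g)
    = of_nat N * ((\<Sum>a<d. \<Sum>c<d. t a a c c) + (\<Sum>a<d. \<Sum>c<d. t a c c a) - (\<Sum>a<d. t a a a a))"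
proof -
  let ?\<omega> = "cis (2 * pi / real N)"
  \<comment> \<open>\<open>N\<close> exceeds every sum of two phase exponents, so for such sums
    congruence modulo \<open>N\<close> is equality.\<close>
  have pow: "2 ^ i + 2 ^ j < N" if "i < d" "j < d" for i j
  proof -
    have "(2::nat) ^ i \<le> 2 ^ d" "(2::nat) ^ j \<le> 2 ^ d"
      using that by (intro power_increasing; simp)+
    then show ?thesis
      unfolding N_def by linarith
  qed
  have avg: "(\<Sum>k<N. cnj (z k a) * z k b * cnj (z k c) * z k g)
      = of_nat N * of_bool (2 ^ b + 2 ^ g = (2 ^ a + 2 ^ c :: nat))"
    if "a < d" "b < d" "c < d" "g < d" for a b c g
  proof -
    have "cnj (z k a) * z k b * cnj (z k c) * z k g
        = (?\<omega> ^ (2 ^ b + 2 ^ g) * cnj ?\<omega> ^ (2 ^ a + 2 ^ c)) ^ k" for k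
      by (simp add: z_def power_add power_mult_distrib mult_ac flip: power_mult)
    then show ?thesis
      using sum_root_of_unity_powers[OF pow[OF that(2,4)] pow[OF that(1,3)] refl] by simp
  qed
  \<comment> \<open>In each product the first indicator fixes the innermost index \<open>g\<close>,
    so \<open>delta\<close> collapses the sums from the inside out.\<close>
  have split: "of_bool (2 ^ b + 2 ^ g = (2 ^ a + 2 ^ c :: nat)) * t a b c g
    = of_bool (g = c) * (of_bool (b = a) * t a b c g) + of_bool (g = a) * (of_bool (c = b) * t a b c g)
      - of_bool (g = a) * (of_bool (c = a) * (of_bool (b = a) * t a b c g))" for a b c g
    unfolding sum_of_two_powers_eq_iff by auto
  have delta: "(\<Sum>x<d. of_bool (x = y) * f x) = f y" if "y < d" for y and f :: "nat \<Rightarrow> complex"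
    using that by (simp add: of_bool_def if_distrib if_distribR cong: if_cong)
  have "(\<Sum>k<N. \<Sum>a<d. \<Sum>b<d. \<Sum>c<d. \<Sum>g<d. cnj (z k a) * z k b * cnj (z k c) * z k g * t a b c g)
      = (\<Sum>a<d. \<Sum>b<d. \<Sum>c<d. \<Sum>g<d. \<Sum>k<N. cnj (z k a) * z k b * cnj (z k c) * z k g * t a b c g)"
    by (simp only: sum.swap[of _ _ "{..<N}"])
  also have "\<dots> = of_nat N * (\<Sum>a<d. \<Sum>b<d. \<Sum>c<d. \<Sum>g<d.
      of_bool (2 ^ b + 2 ^ g = (2 ^ a + 2 ^ c :: nat)) * t a b c g)"
    unfolding sum_distrib_left by (intro sum.cong refl) (simp add: avg sum_distrib_right[symmetric])
  also have "(\<Sum>a<d. \<Sum>b<d. \<Sum>c<d. \<Sum>g<d. of_bool (2 ^ b + 2 ^ g = (2 ^ a + 2 ^ c :: nat)) * t a b c g)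
      = (\<Sum>a<d. \<Sum>c<d. t a a c c) + (\<Sum>a<d. \<Sum>c<d. t a c c a) - (\<Sum>a<d. t a a a a)"
    unfolding split sum.distrib sum_subtractf
    by (simp add: delta del: sum_mult_of_bool_eq sum_of_bool_mult_eq flip: sum_distrib_left)
  finally show ?thesis .
qed

section \<open>The reduction inequality for matrices with commuting entries\<close>

lemma scaleC_sum_right: "c *\<^sub>C (\<Sum>i\<in>I. f i) = (\<Sum>i\<in>I. c *\<^sub>C (f i :: 'a::chilbert_space))"
  by (induction I rule: infinite_finite_induct) (simp_all add: scaleC_add_right)

lemma scaleC_sum_left: "(\<Sum>i\<in>I. f i) *\<^sub>C x = (\<Sum>i\<in>I. f i *\<^sub>C (x :: 'a::chilbert_space))"
  by (induction I rule: infinite_finite_induct) (simp_all add: scaleC_add_left)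

text \<open>The form of the left side is half the sum of the \<open>2\<close> by \<open>2\<close> forms of
  \<open>positive_block_swap\<close> at \<open>(x a, - x c)\<close> over all pairs of indices \<open>a, c\<close>.\<close>

lemma commuting_reduction_positive:
  fixes X :: "nat \<Rightarrow> nat \<Rightarrow> ('a::chilbert_space \<Rightarrow>\<^sub>L 'a)"
  assumes bops: "\<And>i j. i < d \<Longrightarrow> j < d \<Longrightarrow> X i j \<in> bops"
    and comm: "\<And>i j k l. i < d \<Longrightarrow> j < d \<Longrightarrow> k < d \<Longrightarrow> l < d \<Longrightarrow> X i j o\<^sub>L X k l = X k l o\<^sub>L X i j"
    and pos: "matrix_positive d X"
  shows "matrix_positive d (\<lambda>i j. of_bool (i = j) *\<^sub>R (\<Sum>k<d. X k k) - X i j)"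
proof -
  have delta: "(\<Sum>i<d. of_bool (i = a) * f i) = f a" if "a < d" for a and f :: "nat \<Rightarrow> complex"
    using that by (simp add: of_bool_def if_distrib if_distribR cong: if_cong)
  let ?F = "\<lambda>i j x y. cinner x (blinfun_apply (X i j) y)"
  have block: "?F a a x x + ?F a c x y + ?F c a y x + ?F c c y y \<in> \<real>\<^sub>\<ge>\<^sub>0"
    if "a < d" "c < d" for a c x y
  proof -
    \<comment> \<open>Adding the two contributions covers \<open>a = c\<close> as well, where the
      block form is the form of \<open>X a a\<close> at \<open>x + y\<close>.\<close>
    define v where "v i = of_bool (i = a) *\<^sub>R x + of_bool (i = c) *\<^sub>R y" for i
    have "?F i j (v i) (v j) = of_bool (j = a) * (of_bool (i = a) * ?F i j x x)
        + of_bool (j = c) * (of_bool (i = a) * ?F i j x y)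
        + of_bool (j = a) * (of_bool (i = c) * ?F i j y x)
        + of_bool (j = c) * (of_bool (i = c) * ?F i j y y)" for i j
      by (simp add: v_def blinfun.add_right blinfun.scaleR_right cinner_simps algebra_simps)
    then have "(\<Sum>i<d. \<Sum>j<d. ?F i j (v i) (v j)) = ?F a a x x + ?F a c x y + ?F c a y x + ?F c c y y"
      using that
      by (simp add: sum.distrib delta del: sum_mult_of_bool_eq sum_of_bool_mult_eq)
    then show ?thesis
      using pos[unfolded matrix_positive_def, THEN spec, of v] by (simp only:)
  qed
  show ?thesis
    unfolding matrix_positive_def
  proof
    fix x :: "nat \<Rightarrow> 'a"
    let ?H = "\<lambda>i j. cinner (x i)
      (blinfun_apply (of_bool (i = j) *\<^sub>R (\<Sum>k<d. X k k) - X i j) (x j))"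
    let ?G = "\<lambda>a c. ?F c c (x a) (x a) + ?F a c (x a) (- x c) + ?F c a (- x c) (x a)
      + ?F a a (- x c) (- x c)"
    have "?G a c \<in> \<real>\<^sub>\<ge>\<^sub>0" if "a < d" "c < d" for a c
      by (rule positive_block_swap) (use that in \<open>simp_all add: bops comm block\<close>)
    then have "(\<Sum>a<d. \<Sum>c<d. ?G a c) \<in> \<real>\<^sub>\<ge>\<^sub>0"
      by (intro sum_in_nonneg_Reals) simp_all
    \<comment> \<open>Exchanging the names \<open>a\<close> and \<open>c\<close> identifies the two
      diagonal sums, and likewise the two cross sums; hence the factor 2.\<close>
    moreover have "(\<Sum>a<d. \<Sum>c<d. ?G a c) = 2 * (\<Sum>i<d. \<Sum>j<d. ?H i j)"
    proof -
      have "?H i j = of_bool (j = i) * (\<Sum>k<d. ?F k k (x i) (x j)) - ?F i j (x i) (x j)" for i j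
        by (auto simp: blinfun.diff_left blinfun.scaleR_left blinfun.sum_left cinner_simps cinner_sum_right)
      then have "(\<Sum>i<d. \<Sum>j<d. ?H i j)
          = (\<Sum>i<d. \<Sum>k<d. ?F k k (x i) (x i)) - (\<Sum>i<d. \<Sum>j<d. ?F i j (x i) (x j))"
        by (simp add: sum_subtractf delta del: sum_mult_of_bool_eq sum_of_bool_mult_eq)
      moreover have "(\<Sum>a<d. \<Sum>c<d. ?F a a (x c) (x c)) = (\<Sum>a<d. \<Sum>c<d. ?F c c (x a) (x a))"
        "(\<Sum>a<d. \<Sum>c<d. ?F c a (x c) (x a)) = (\<Sum>a<d. \<Sum>c<d. ?F a c (x a) (x c))"
        by (rule sum.swap)+
      ultimately show ?thesis
        by (simp add: sum.distrib sum_subtractf blinfun.minus_right cinner_minus_left cinner_minus_right)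
    qed
    ultimately show "(\<Sum>i<d. \<Sum>j<d. ?H i j) \<in> \<real>\<^sub>\<ge>\<^sub>0"
      by (simp add: nonneg_Reals_iff)
  qed
qed

section \<open>Linear maps on \<open>bops\<close> and their quartic forms\<close>

text \<open>Restricted to \<open>bops\<close> because the type also contains operators that are
  merely real-linear, on which the notion of CP-map imposes nothing.\<close>

definition bops_linear :: "(('a::chilbert_space \<Rightarrow>\<^sub>L 'a) \<Rightarrow> ('b::chilbert_space \<Rightarrow>\<^sub>L 'b)) \<Rightarrow> bool" where
  "bops_linear T \<longleftrightarrow> (\<forall>A\<in>bops. \<forall>B\<in>bops. T (A + B) = T A + T B) \<and>
    (\<forall>c. \<forall>A\<in>bops. T (op_scaleC c A) = op_scaleC c (T A))"

lemma bops_linear_scale: "bops_linear T \<Longrightarrow> A \<in> bops \<Longrightarrow> T (op_scaleC c A) = op_scaleC c (T A)"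
  by (simp add: bops_linear_def)

lemma bops_linear_add: "bops_linear T \<Longrightarrow> A \<in> bops \<Longrightarrow> B \<in> bops \<Longrightarrow> T (A + B) = T A + T B"
  by (simp add: bops_linear_def)

lemma bops_linear_zero: "bops_linear T \<Longrightarrow> T 0 = 0"
  using bops_linear_scale[of T 0 0] by simp

lemma bops_linear_minus: "bops_linear T \<Longrightarrow> A \<in> bops \<Longrightarrow> T (- A) = - T A"
  using bops_linear_scale[of T A "- 1"] by (simp add: op_scaleC_minus_one)

lemma bops_linear_diff: "bops_linear T \<Longrightarrow> A \<in> bops \<Longrightarrow> B \<in> bops \<Longrightarrow> T (A - B) = T A - T B"
  using bops_linear_add[of T A "- B"] by (simp add: bops_linear_minus)

lemma bops_linear_sum:
  assumes "bops_linear T" and "\<And>i. i \<in> I \<Longrightarrow> f i \<in> bops"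
  shows "T (\<Sum>i\<in>I. f i) = (\<Sum>i\<in>I. T (f i))"
  using assms(2)
  by (induction I rule: infinite_finite_induct)
    (simp_all add: bops_linear_zero bops_linear_add assms(1))

lemma rank_one_sum:
  "rank_one (\<Sum>i\<in>I. z i *\<^sub>C e i) (\<Sum>j\<in>J. w j *\<^sub>C f j)
    = (\<Sum>i\<in>I. \<Sum>j\<in>J. op_scaleC (z i * cnj (w j)) (rank_one (e i) (f j)))"
proof (rule blinfun_eqI)
  fix x
  show "blinfun_apply (rank_one (\<Sum>i\<in>I. z i *\<^sub>C e i) (\<Sum>j\<in>J. w j *\<^sub>C f j)) x
    = blinfun_apply (\<Sum>i\<in>I. \<Sum>j\<in>J. op_scaleC (z i * cnj (w j)) (rank_one (e i) (f j))) x"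
    by (simp add: blinfun.sum_left cinner_sum_left cinner_scaleC_left scaleC_sum_left
        scaleC_sum_right scaleC_scaleC sum_distrib_left mult_ac)
qed

text \<open>Brings the quartic form into the shape averaged in \<open>sum_phase_average\<close>. The
  conjugate at \<open>c\<close> comes from the antilinearity of \<open>rank_one\<close> in its
  second argument.\<close>

lemma quartic_form_expansion:
  assumes T: "bops_linear T" "T ` bops \<subseteq> bops"
    and v: "v = (\<Sum>a\<in>I. z a *\<^sub>C e a)"
  shows "cinner v (blinfun_apply (T (rank_one v v)) v)
    = (\<Sum>a\<in>I. \<Sum>b\<in>I. \<Sum>c\<in>I. \<Sum>g\<in>I. cnj (z a) * z b * cnj (z c) * z g
        * cinner (e a) (blinfun_apply (T (rank_one (e b) (e c))) (e g)))"
proof -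
  have "T (rank_one v v) = (\<Sum>b\<in>I. \<Sum>c\<in>I. op_scaleC (z b * cnj (z c)) (T (rank_one (e b) (e c))))"
    unfolding v rank_one_sum by (simp add: bops_linear_sum bops_linear_scale T(1))
  moreover have "T (rank_one x y) \<in> bops" for x y
    using T(2) by auto
  then have "blinfun_apply (T (rank_one (e b) (e c))) v
      = (\<Sum>g\<in>I. z g *\<^sub>C blinfun_apply (T (rank_one (e b) (e c))) (e g))" for b c
    by (simp add: v blinfun.sum_right in_bopsD)
  ultimately have W: "blinfun_apply (T (rank_one v v)) v
      = (\<Sum>b\<in>I. \<Sum>c\<in>I. \<Sum>g\<in>I.
          (z b * cnj (z c) * z g) *\<^sub>C blinfun_apply (T (rank_one (e b) (e c))) (e g))"
    by (simp add: blinfun.sum_left scaleC_sum_right scaleC_scaleC)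
  have "cinner v w = (\<Sum>a\<in>I. cnj (z a) * cinner (e a) w)" for w
    by (simp add: v cinner_sum_left cinner_scaleC_left)
  from this[of "blinfun_apply (T (rank_one v v)) v"] show ?thesis
    unfolding W
    by (simp add: cinner_sum_right cinner_scaleC_right sum_distrib_left mult_ac)
qed

text \<open>Dividing \<open>rank_one v v\<close> by the squared norm of \<open>v\<close> gives a
  projection \<open>P\<close>, which is an admissible test operator. The form of
  \<open>P - T P\<close> at \<open>v\<close> is at most \<Delta> times the squared norm; multiplying
  by that squared norm gives the bound.\<close>

lemma quartic_form_lower_bound:
  assumes T: "bops_linear T"
    and \<Delta>: "\<And>B. B \<in> bops \<Longrightarrow> op_le 0 B \<Longrightarrow> op_le B id_blinfun \<Longrightarrow> norm (B - T B) \<le> \<Delta>"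
  shows "(1 - \<Delta>) * ((norm v)\<^sup>2)\<^sup>2 \<le> Re (cinner v (blinfun_apply (T (rank_one v v)) v))"
proof (cases "v = 0")
  case False
  define P where "P = op_scaleC (of_real (1 / (norm v)\<^sup>2)) (rank_one v v)"
  define q where "q = Re (cinner v (blinfun_apply (T (rank_one v v)) v))"
  have P: "P \<in> bops"
    by (simp add: P_def)
  have form: "cinner x (blinfun_apply P x) = of_real ((cmod (cinner v x))\<^sup>2 / (norm v)\<^sup>2)" for x
    using cinner_commute[of x v]
    by (simp add: P_def cinner_simps complex_norm_square mult_ac del: of_real_power)
  have "(cmod (cinner v x))\<^sup>2 / (norm v)\<^sup>2 \<le> (norm x)\<^sup>2" for x
    using power_mono[OF norm_cinner_le[of v x], of 2] False
    by (simp add: power_mult_distrib divide_simps mult_ac)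
  then have "norm (P - T P) \<le> \<Delta>"
    by (intro \<Delta> P)
      (simp_all add: op_le_def op_positive_def blinfun.diff_left cinner_diff_right form cinner_self
        nonneg_Reals_iff del: of_real_power of_real_divide)
  have TP: "T P = op_scaleC (of_real (1 / (norm v)\<^sup>2)) (T (rank_one v v))"
    by (simp add: P_def bops_linear_scale T)
  have "Re (cinner v (blinfun_apply P v)) = (norm v)\<^sup>2"
    unfolding form using False
    by (simp add: cinner_self power2_eq_square norm_mult del: of_real_divide)
  moreover have "Re (cinner v (blinfun_apply (T P) v)) = q / (norm v)\<^sup>2"
    by (simp add: TP cinner_scaleC_right q_def Re_divide_of_real flip: of_real_power)
  ultimately have "(norm v)\<^sup>2 - q / (norm v)\<^sup>2 = Re (cinner v (blinfun_apply (P - T P) v))"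
    by (simp add: blinfun.diff_left cinner_diff_right)
  also have "\<dots> \<le> norm v * norm (blinfun_apply (P - T P) v)"
    by (rule Re_cinner_le)
  also have "\<dots> \<le> norm v * (norm (P - T P) * norm v)"
    by (intro mult_left_mono norm_blinfun) simp
  also have "\<dots> \<le> norm v * (\<Delta> * norm v)"
    using \<open>norm (P - T P) \<le> \<Delta>\<close> by (intro mult_left_mono mult_right_mono) simp_all
  finally have "(norm v)\<^sup>2 - q / (norm v)\<^sup>2 \<le> \<Delta> * (norm v)\<^sup>2"
    by (simp add: power2_eq_square mult_ac)
  then have "(1 - \<Delta>) * (norm v)\<^sup>2 \<le> q / (norm v)\<^sup>2"
    by (simp add: algebra_simps)
  then show ?thesis
    using False by (simp add: q_def field_simps power2_eq_square)
qed simp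

section \<open>CP-maps and the estimate of the coding imperfection\<close>

lemma cp_map_matrix_positive:
  assumes "cp_map M N \<Phi>" "\<And>i j. P i j \<in> M" "matrix_positive n P"
  shows "matrix_positive n (\<lambda>i j. \<Phi> (P i j))"
  using assms by (simp add: cp_map_def completely_positive_on_def)

lemma cp_map_positive:
  assumes "cp_map M N \<Phi>" "A \<in> M" "op_positive A"
  shows "op_positive (\<Phi> A)"
proof -
  have "matrix_positive 1 (\<lambda>i j. A)"
    using assms(3) by (simp add: matrix_positive_def op_positive_def)
  then have "matrix_positive 1 (\<lambda>i j. \<Phi> A)"
    by (rule cp_map_matrix_positive[OF assms(1,2)])
  then have "cinner x (blinfun_apply (\<Phi> A) x) \<in> \<real>\<^sub>\<ge>\<^sub>0" for x
    unfolding matrix_positive_def by (auto dest: spec[of _ "\<lambda>_. x"])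
  then show ?thesis
    by (simp add: op_positive_def)
qed

theorem mainTheorem7:
  fixes E :: "'h::chilbert_space set"
    and d :: nat
    and \<A> :: "('k::chilbert_space \<Rightarrow>\<^sub>L 'k) set"
    and C :: "('k \<Rightarrow>\<^sub>L 'k) \<Rightarrow> ('h \<Rightarrow>\<^sub>L 'h)"
    and D :: "('h \<Rightarrow>\<^sub>L 'h) \<Rightarrow> ('k \<Rightarrow>\<^sub>L 'k)"
  assumes "finite_dimensional_vector_space (scaleC :: complex \<Rightarrow> 'h \<Rightarrow> 'h) E"
    and "vector_space.dim (scaleC :: complex \<Rightarrow> 'h \<Rightarrow> 'h) UNIV = d"
    and "classical_coding_procedure \<A> C D"
  shows "coding_imperfection C D \<ge> (real d - 1) / (real d + 1)"
proof -
  obtain e :: "nat \<Rightarrow> 'h"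
    where ortho: "\<And>i j. i < d \<Longrightarrow> j < d \<Longrightarrow> cinner (e i) (e j) = of_bool (i = j)"
      and expand: "\<And>v. v = (\<Sum>i<d. cinner (e i) v *\<^sub>C e i)"
    using orthonormal_basis_exists[OF assms(1,2)] by blast
  have resolution: "(\<Sum>i<d. rank_one (e i) (e i)) = id_blinfun"
    by (rule blinfun_eqI) (use expand in \<open>simp add: blinfun.sum_left\<close>)
  have A_bops: "\<A> \<subseteq> bops" and A_comm: "\<And>A B. A \<in> \<A> \<Longrightarrow> B \<in> \<A> \<Longrightarrow> A o\<^sub>L B = B o\<^sub>L A"
    and C: "cp_map \<A> bops C" and D: "cp_map bops \<A> D"
    using assms(3)
    by (auto simp: classical_coding_procedure_def von_neumann_algebra_def commutative_algebra_def)
  have D_in: "D B \<in> \<A>" if "B \<in> bops" for B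
    using D that by (auto simp: cp_map_def)
  define T where "T B = C (D B)" for B
  have D_lin: "bops_linear D"
    using D by (simp add: cp_map_def bops_linear_def)
  have T_lin: "bops_linear T"
    using C D D_in by (simp add: cp_map_def bops_linear_def T_def)
  have T_bops: "T ` bops \<subseteq> bops"
    using C D_in by (auto simp: cp_map_def T_def)
  have unital: "D id_blinfun = id_blinfun" "T id_blinfun = id_blinfun"
    using C D by (simp_all add: cp_map_def T_def)
  have T_pos: "op_positive (T B)" if "B \<in> bops" "op_positive B" for B
    unfolding T_def by (intro cp_map_positive[OF C] cp_map_positive[OF D] D_in that)
  define U :: "('h \<Rightarrow>\<^sub>L 'h) set" where "U = {B \<in> bops. op_le 0 B \<and> op_le B id_blinfun}"
  define \<Delta> where "\<Delta> = coding_imperfection C D"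
  have norm_le_1: "norm B \<le> 1" if "B \<in> U" for B
    using that by (intro norm_le_1_if_op_le_id) (auto simp: U_def)
  have T_U: "T B \<in> U" if "B \<in> U" for B
  proof -
    have "op_positive (T B)" "op_positive (T (id_blinfun - B))"
      using that by (auto simp: U_def op_le_def intro!: T_pos)
    then show ?thesis
      using that T_bops by (auto simp: U_def op_le_def bops_linear_diff T_lin unital)
  qed
  \<comment> \<open>Any bound suffices: it only serves to make the real supremum an upper
    bound.\<close>
  have "norm (B - T B) \<le> 2" if "B \<in> U" for B
    using norm_triangle_ineq4[of B "T B"] norm_le_1[OF that] norm_le_1[OF T_U[OF that]] by linarith
  then have "bdd_above ((\<lambda>B. norm (B - T B)) ` U)"
    by (rule bdd_aboveI2)
  then have \<Delta>: "norm (B - T B) \<le> \<Delta>" if "B \<in> U" for B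
    using that unfolding \<Delta>_def coding_imperfection_def U_def[symmetric] T_def[symmetric]
    by (intro cSUP_upper)
  \<comment> \<open>Needed for \<open>d = 0\<close>, where the final inequality, which carries a
    factor \<open>d\<close>, says nothing.\<close>
  have "0 \<in> U"
    by (simp add: U_def op_le_def op_positive_def cinner_self)
  then have "0 \<le> \<Delta>"
    using \<Delta> norm_ge_zero order_trans by blast
  define t where "t a b c g = cinner (e a) (blinfun_apply (T (rank_one (e b) (e c))) (e g))" for a b c g
  define S where "S = (\<Sum>a<d. \<Sum>c<d. t a a c c)"
  have "Re S \<le> real d"
  proof -
    define X where "X = (\<lambda>i j. D (rank_one (e i) (e j)))"
    \<comment> \<open>For \<open>d \<ge> 2\<close> the matrix \<open>P\<close> is not positive: at
      the vector with components \<open>e i\<close> its form is \<open>d - d\<^sup>2\<close>. Its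
      image under \<open>D\<close> is positive, because it is the reduction of the commuting matrix
      \<open>X\<close>, whose trace is the identity.\<close>
    define P where "P i j = of_bool (i = j) *\<^sub>R id_blinfun - rank_one (e i) (e j)" for i j
    have P_bops: "P i j \<in> bops" for i j
      by (simp add: P_def)
    have X: "X i j \<in> \<A>" for i j
      by (simp add: X_def D_in)
    have "matrix_positive d (\<lambda>i j. rank_one (e i) (e j))"
      unfolding matrix_positive_def
    proof
      fix x :: "nat \<Rightarrow> 'h"
      have "(\<Sum>i<d. \<Sum>j<d. cinner (x i) (blinfun_apply (rank_one (e i) (e j)) (x j)))
          = cnj (\<Sum>i<d. cinner (e i) (x i)) * (\<Sum>j<d. cinner (e j) (x j))"
        by (simp add: cinner_scaleC_right sum_product cinner_commute[of "x _" "e _"])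
          (simp add: mult.commute)
      then show "(\<Sum>i<d. \<Sum>j<d. cinner (x i) (blinfun_apply (rank_one (e i) (e j)) (x j))) \<in> \<real>\<^sub>\<ge>\<^sub>0"
        by (simp add: complex_norm_square[symmetric] mult.commute[of "cnj _"] del: cnj_sum)
    qed
    then have "matrix_positive d X"
      unfolding X_def by (rule cp_map_matrix_positive[OF D rank_one_in_bops])
    then have "matrix_positive d (\<lambda>i j. of_bool (i = j) *\<^sub>R (\<Sum>k<d. X k k) - X i j)"
      using X A_bops by (intro commuting_reduction_positive A_comm) auto
    moreover have "(\<Sum>k<d. X k k) = id_blinfun"
      by (simp add: X_def resolution unital flip: bops_linear_sum[OF D_lin])
    moreover have "D (P i j) = of_bool (i = j) *\<^sub>R id_blinfun - X i j" for i j
      by (auto simp: P_def X_def bops_linear_diff bops_linear_minus bops_linear_zero D_lin unital)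
    ultimately have "matrix_positive d (\<lambda>i j. D (P i j))"
      by simp
    then have "matrix_positive d (\<lambda>i j. T (P i j))"
      unfolding T_def by (rule cp_map_matrix_positive[OF C D_in[OF P_bops]])
    \<comment> \<open>Evaluation at the vector with components \<open>e i\<close>.\<close>
    then have "0 \<le> Re (\<Sum>i<d. \<Sum>j<d. cinner (e i) (blinfun_apply (T (P i j)) (e j)))"
      by (simp add: matrix_positive_def nonneg_Reals_iff)
    also have "(\<Sum>i<d. \<Sum>j<d. cinner (e i) (blinfun_apply (T (P i j)) (e j)))
        = (\<Sum>i<d. \<Sum>j<d. of_bool (i = j) - t i i j j)"
    proof (intro sum.cong refl)
      fix i j
      assume "i \<in> {..<d}" "j \<in> {..<d}"
      then show "cinner (e i) (blinfun_apply (T (P i j)) (e j)) = of_bool (i = j) - t i i j j"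
        by (auto simp: P_def t_def bops_linear_diff bops_linear_minus bops_linear_zero T_lin unital blinfun.diff_left
            blinfun.minus_left cinner_simps ortho)
    qed
    also have "\<dots> = of_nat d - S"
      by (simp add: S_def sum_subtractf of_bool_def)
    finally show ?thesis
      by simp
  qed
  define Q where "Q v = cinner v (blinfun_apply (T (rank_one v v)) v)" for v
  have Q: "(1 - \<Delta>) * ((norm v)\<^sup>2)\<^sup>2 \<le> Re (Q v)" for v
    unfolding Q_def using T_lin \<Delta> by (rule quartic_form_lower_bound) (simp add: U_def)
  define N :: nat where "N = 2 * 2 ^ d + 1"
  define z where "z k a = cis (2 * pi / real N) ^ (2 ^ a * k)" for k a :: nat
  \<comment> \<open>All coordinates have modulus 1, so every phase vector has squared norm
    \<open>d\<close> and contributes at least \<open>(1 - \<Delta>) * d\<^sup>2\<close>.\<close>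
  define \<psi> where "\<psi> k = (\<Sum>a<d. z k a *\<^sub>C e a)" for k
  have "cmod (z k a) = 1" for k a
    by (simp add: z_def norm_power)
  then have z: "z k a * cnj (z k a) = 1" for k a
    by (simp add: complex_norm_square[symmetric])
  have "cinner (\<psi> k) (\<psi> k) = of_nat d" for k
    by (simp add: \<psi>_def cinner_sum_left cinner_sum_right cinner_simps ortho z)
  then have \<psi>: "(norm (\<psi> k))\<^sup>2 = real d" for k
    by (metis cinner_self of_real_eq_iff of_real_of_nat_eq)
  have e: "norm (e a) = 1" if "a < d" for a
    using ortho[OF that that] by (simp add: norm_eq_sqrt_cinner)
  \<comment> \<open>Unitality of \<open>T\<close> fixes this pairing exactly, whereas
    \<open>S\<close> could only be estimated.\<close>
  have "(\<Sum>a<d. \<Sum>c<d. t a c c a) = of_nat d"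
  proof -
    have "(\<Sum>c<d. T (rank_one (e c) (e c))) = id_blinfun"
      by (simp add: resolution unital flip: bops_linear_sum[OF T_lin])
    then have "(\<Sum>c<d. t a c c a) = cinner (e a) (e a)" for a
      by (simp add: t_def flip: cinner_sum_right blinfun.sum_left)
    then show ?thesis
      by (simp add: ortho)
  qed
  \<comment> \<open>The doubly counted terms \<open>t a a a a\<close> are the values
    \<open>Q (e a)\<close>; this is why the basis vectors complete the 2-design.\<close>
  then have "(\<Sum>k<N. Q (\<psi> k)) = of_nat N * (S + of_nat d - (\<Sum>a<d. Q (e a)))"
    unfolding Q_def quartic_form_expansion[OF T_lin T_bops \<psi>_def] t_def[symmetric]
    using sum_phase_average[of d t] by (simp only: S_def N_def z_def)
  then have "(\<Sum>k<N. Re (Q (\<psi> k))) = real N * (Re S + real d - (\<Sum>a<d. Re (Q (e a))))"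
    by (simp flip: Re_sum)
  moreover have "real N * ((1 - \<Delta>) * (real d)\<^sup>2) \<le> (\<Sum>k<N. Re (Q (\<psi> k)))"
    using sum_mono[of "{..<N}" "\<lambda>k. (1 - \<Delta>) * (real d)\<^sup>2" "\<lambda>k. Re (Q (\<psi> k))"] Q[of "\<psi> _"]
    by (simp add: \<psi>)
  moreover have "0 < real N"
    unfolding of_nat_0_less_iff by (simp add: N_def)
  ultimately have "(1 - \<Delta>) * (real d)\<^sup>2 \<le> Re S + real d - (\<Sum>a<d. Re (Q (e a)))"
    by (metis mult_le_cancel_left_pos)
  moreover have "real d * (1 - \<Delta>) \<le> (\<Sum>a<d. Re (Q (e a)))"
  proof -
    have "1 - \<Delta> \<le> Re (Q (e a))" if "a < d" for a
      using Q[of "e a"] e[OF that] by simp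
    then show ?thesis
      using sum_mono[of "{..<d}" "\<lambda>a. 1 - \<Delta>" "\<lambda>a. Re (Q (e a))"] by simp
  qed
  ultimately have "(1 - \<Delta>) * (real d)\<^sup>2 + real d * (1 - \<Delta>) \<le> 2 * real d"
    using \<open>Re S \<le> real d\<close> by linarith
  then have "real d * ((1 - \<Delta>) * (real d + 1)) \<le> real d * 2"
    by (simp add: algebra_simps power2_eq_square)
  then have "(real d - 1) / (real d + 1) \<le> \<Delta>"
  \<comment> \<open>For \<open>d = 0\<close> the claimed bound is -1; otherwise the factor
    \<open>d\<close> cancels.\<close>
  proof (cases "d = 0")
    case False
    then have "(1 - \<Delta>) * (real d + 1) \<le> 2"
      using \<open>real d * ((1 - \<Delta>) * (real d + 1)) \<le> real d * 2\<close>
      by (simp only: mult_le_cancel_left_pos of_nat_0_less_iff)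
    then show ?thesis
      by (simp add: field_simps)
  qed (use \<open>0 \<le> \<Delta>\<close> in simp)
  then show ?thesis
    by (simp add: \<Delta>_def)
qed

end
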